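(* Let $X\neq\{0\}$ be a real Hilbert space, let $m\in\{2,3,\ldots\}$, let $R\colon X\to X$ be a linear isometry with $R^m=\operatorname{Id}$, let $M:=\operatorname{Id}-R$, and let $\gamma>0$. Then $$J_{\gamma M^{-1}}=\operatorname{Id}-J_{(1/\gamma)M},$$ $${}^{\gamma}M=\tfrac1\gamma\big(\operatorname{Id}-J_{\gamma M}\big),$$ and $${}^{\gamma}(M^{-1})=\tfrac1\gamma J_{(1/\gamma)M}=\frac{1}{(1+\gamma)^m-1}\sum_{k=0}^{m-1}(1+\gamma)^{m-1-k}R^k.$$
   Context: $\operatorname{Id}$ is the identity operator on $X$. $M^{-1}$ is the set-valued inverse of $M$: $M^{-1}y=\{x\in X: Mx=y\}$. Both $M$ and $M^{-1}$ are maximally monotone. For a maximally monotone (possibly set-valued) operator $A$ on $X$, the resolvent is $J_A:=(\operatorname{Id}+A)^{-1}$, which is single-valued with full domain $X$, and the Yosida approximation of $A$ of index $\gamma>0$ is ${}^{\gamma}A:=\tfrac1\gamma(\operatorname{Id}-J_{\gamma A})$. *)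

theory Defs
  imports "HOL-Analysis.Analysis"
begin

text \<open>
  A set-valued operator \<open>A : X \<rightrightarrows> X\<close> is a function \<open>'a \<Rightarrow> 'a set\<close>. A single-valued operator
  with full domain is identified with the operator all of whose values are singletons
  (\<open>sv_of\<close> below), so an equation between set-valued operators whose right-hand side is
  \<open>sv_of f\<close> also asserts that the left-hand side is single-valued with full domain.
\<close>

type_synonym 'a sv_op = "'a \<Rightarrow> 'a set"

definition sv_of :: "('a \<Rightarrow> 'a) \<Rightarrow> 'a sv_op" where
  "sv_of f = (\<lambda>x. {f x})"

abbreviation sv_Id :: "'a sv_op" where
  "sv_Id \<equiv> sv_of (\<lambda>x. x)"

definition sv_inverse :: "'a sv_op \<Rightarrow> 'a sv_op" where
  "sv_inverse A = (\<lambda>y. {x. y \<in> A x})"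

definition sv_add :: "'a::real_vector sv_op \<Rightarrow> 'a sv_op \<Rightarrow> 'a sv_op" where
  "sv_add A B = (\<lambda>x. {a + b | a b. a \<in> A x \<and> b \<in> B x})"

text \<open>Elementwise (Minkowski) difference of the values, not set difference.\<close>

definition sv_diff :: "'a::real_vector sv_op \<Rightarrow> 'a sv_op \<Rightarrow> 'a sv_op" where
  "sv_diff A B = (\<lambda>x. {a - b | a b. a \<in> A x \<and> b \<in> B x})"

definition sv_scale :: "real \<Rightarrow> 'a::real_vector sv_op \<Rightarrow> 'a sv_op" where
  "sv_scale c A = (\<lambda>x. (\<lambda>a. c *\<^sub>R a) ` A x)"

text \<open>
  The resolvent \<open>(Id + A)\<^sup>-\<^sup>1\<close> is taken in the set-valued sense, so that it makes sense for every
  \<open>A\<close>; for maximally monotone \<open>A\<close> on a Hilbert space all of its values are singletons.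
\<close>

definition resolvent :: "'a::real_vector sv_op \<Rightarrow> 'a sv_op" where
  "resolvent A = sv_inverse (sv_add sv_Id A)"

definition yosida :: "real \<Rightarrow> 'a::real_vector sv_op \<Rightarrow> 'a sv_op" where
  "yosida \<gamma> A = sv_scale (1 / \<gamma>) (sv_diff sv_Id (resolvent (sv_scale \<gamma> A)))"

end

theory Submission
  imports Defs
begin

text \<open>
  The first three equations are formal. The inverse resolvent identity
  \<open>J\<^bsub>A\<^sup>-\<^sup>1\<^esub> = Id - J\<^bsub>A\<^esub>\<close> holds for every set-valued \<open>A\<close>: both sides at \<open>x\<close> describe the
  splittings \<open>x = y + b\<close> with \<open>y \<in> A b\<close>, once read off from \<open>y\<close> and once from \<open>b\<close>
  (\<open>resolvent_sv_inverse\<close>). Since \<open>M = Id - R\<close> is linear, \<open>\<gamma>M\<^sup>-\<^sup>1\<close> is the inverse of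
  \<open>(1/\<gamma>)M\<close> (\<open>sv_scale_sv_inverse_linear\<close>), which gives the formula for \<open>J\<^bsub>\<gamma>M\<^sup>-\<^sup>1\<^esub>\<close>. Subtracting
  that from \<open>Id\<close> once more returns \<open>J\<^bsub>(1/\<gamma>)M\<^esub>\<close>, whence the Yosida approximation of \<open>M\<^sup>-\<^sup>1\<close>.
  The middle equation is the definition of the Yosida approximation of \<open>M\<close>.

  The closed form rests on \<open>R\<^sup>m = Id\<close>. With \<open>a = 1 + \<gamma>\<close>, the condition \<open>y \<in> J\<^bsub>(1/\<gamma>)M\<^esub> x\<close>
  reads \<open>(a Id - R) y = \<gamma> x\<close>. The operator \<open>a Id - R\<close> is inverted by a finite geometric sum:
  \<open>S = \<Sum>k<m. a\<^bsup>m-1-k\<^esup> R\<^sup>k\<close> commutes with \<open>R\<close> and satisfies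
  \<open>(a Id - R) S = a\<^sup>m Id - R\<^sup>m = (a\<^sup>m - 1) Id\<close>, where \<open>a\<^sup>m > 1\<close>. Hence the unique solution is
  \<open>y = \<gamma> S x / (a\<^sup>m - 1)\<close>.
\<close>

section \<open>Calculus of set-valued resolvents\<close>

lemma mem_resolvent_iff: "y \<in> resolvent A x \<longleftrightarrow> x - y \<in> A y"
proof -
  have "(\<exists>b. x = y + b \<and> b \<in> A y) \<longleftrightarrow> x - y \<in> A y"
    by (metis add_diff_cancel_left' diff_add_cancel add.commute)
  then show ?thesis
    by (simp add: resolvent_def sv_inverse_def sv_add_def sv_of_def)
qed

lemma mem_sv_diff_Id_iff: "y \<in> sv_diff sv_Id A x \<longleftrightarrow> x - y \<in> A x"
proof -
  have "(\<exists>b. y = x - b \<and> b \<in> A x) \<longleftrightarrow> x - y \<in> A x"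
    by (metis diff_diff_eq2 add_diff_cancel_left')
  then show ?thesis
    by (simp add: sv_diff_def sv_of_def)
qed

lemma mem_sv_scale_iff:
  assumes "c \<noteq> 0"
  shows "y \<in> sv_scale c A x \<longleftrightarrow> (1 / c) *\<^sub>R y \<in> A x"
proof
  assume "y \<in> sv_scale c A x"
  then show "(1 / c) *\<^sub>R y \<in> A x"
    using assms by (auto simp: sv_scale_def)
next
  assume "(1 / c) *\<^sub>R y \<in> A x"
  then have "c *\<^sub>R ((1 / c) *\<^sub>R y) \<in> sv_scale c A x"
    unfolding sv_scale_def by (rule imageI)
  then show "y \<in> sv_scale c A x"
    using assms by simp
qed

lemma resolvent_sv_inverse: "resolvent (sv_inverse A) = sv_diff sv_Id (resolvent A)"
  by (intro ext set_eqI) (simp add: mem_resolvent_iff mem_sv_diff_Id_iff sv_inverse_def)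

lemma sv_diff_Id_involution: "sv_diff sv_Id (sv_diff sv_Id A) = A"
  by (intro ext set_eqI) (simp add: mem_sv_diff_Id_iff)

text \<open>
  In general \<open>cA\<^sup>-\<^sup>1\<close> is the inverse of \<open>x \<mapsto> A (x / c)\<close>; homogeneity of \<open>f\<close> moves the factor
  \<open>1 / c\<close> from the argument to the value.
\<close>

lemma sv_scale_sv_inverse_linear:
  assumes "linear f" and "c \<noteq> 0"
  shows "sv_scale c (sv_inverse (sv_of f)) = sv_inverse (sv_scale (1 / c) (sv_of f))"
proof (intro ext set_eqI)
  fix x y
  have "x \<in> sv_scale c (sv_inverse (sv_of f)) y \<longleftrightarrow> y = f ((1 / c) *\<^sub>R x)"
    using assms by (simp add: mem_sv_scale_iff sv_inverse_def sv_of_def)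
  also have "\<dots> \<longleftrightarrow> y = (1 / c) *\<^sub>R f x"
    using assms by (simp add: linear_scale)
  also have "\<dots> \<longleftrightarrow> x \<in> sv_inverse (sv_scale (1 / c) (sv_of f)) y"
    by (simp add: sv_scale_def sv_inverse_def sv_of_def)
  finally show "x \<in> sv_scale c (sv_inverse (sv_of f)) y
      \<longleftrightarrow> x \<in> sv_inverse (sv_scale (1 / c) (sv_of f)) y" .
qed

section \<open>Inverting the shift of an operator of finite order\<close>

text \<open>
  The factorization of \<open>a\<^sup>n - b\<^sup>n\<close> with the operator \<open>R\<close> in place of \<open>b\<close>: \<open>R\<close> shifts each
  summand to the next power, so all but the two extreme terms cancel.
\<close>

lemma geometric_sum_funpow:
  fixes R :: "'a::real_vector \<Rightarrow> 'a"
  assumes "linear R"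
  shows "a *\<^sub>R (\<Sum>k<n. a ^ (n - 1 - k) *\<^sub>R (R ^^ k) x) - R (\<Sum>k<n. a ^ (n - 1 - k) *\<^sub>R (R ^^ k) x)
       = a ^ n *\<^sub>R x - (R ^^ n) x"
proof -
  define h where "h = (\<lambda>k. a ^ (n - k) *\<^sub>R (R ^^ k) x)"
  have up: "a *\<^sub>R (a ^ (n - 1 - k) *\<^sub>R (R ^^ k) x) = h k" if "k < n" for k
  proof -
    from that have "n - k = Suc (n - 1 - k)" by simp
    then show ?thesis by (simp add: h_def)
  qed
  have "a *\<^sub>R (\<Sum>k<n. a ^ (n - 1 - k) *\<^sub>R (R ^^ k) x) = (\<Sum>k<n. h k)"
    unfolding scaleR_sum_right by (rule sum.cong) (use up in auto)
  moreover have "R (\<Sum>k<n. a ^ (n - 1 - k) *\<^sub>R (R ^^ k) x) = (\<Sum>k<n. h (Suc k))"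
    using assms by (simp add: linear_sum linear_scale h_def)
  moreover have "(\<Sum>k<n. h k) - (\<Sum>k<n. h (Suc k)) = h 0 - h n"
    unfolding sum_subtractf [symmetric] by (rule sum_lessThan_telescope')
  ultimately show ?thesis
    by (simp only: h_def) simp
qed

text \<open>
  The geometric sum is a right inverse of \<open>a Id - R\<close> up to the factor \<open>a\<^sup>m - 1\<close>, so the
  equation has a solution. It commutes with \<open>R\<close>, so it is a left inverse as well, and the
  solution is unique.
\<close>

lemma shifted_finite_order_eq_iff:
  fixes R :: "'a::real_vector \<Rightarrow> 'a"
  assumes R: "linear R" and order: "R ^^ m = id" and nz: "a ^ m \<noteq> 1"
  shows "a *\<^sub>R y - R y = x
     \<longleftrightarrow> y = (1 / (a ^ m - 1)) *\<^sub>R (\<Sum>k<m. a ^ (m - 1 - k) *\<^sub>R (R ^^ k) x)"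
proof -
  define S where "S = (\<lambda>z. \<Sum>k<m. a ^ (m - 1 - k) *\<^sub>R (R ^^ k) z)"
  have pow: "linear (R ^^ k)" for k
  proof (induction k)
    case 0
    then show ?case by (simp add: id_def linear_ident)
  next
    case (Suc k)
    then show ?case using linear_compose [OF _ R] by (simp only: funpow.simps)
  qed
  have S: "linear S"
    unfolding S_def by (intro linear_compose_sum ballI linear_compose_scale_right pow)
  have comm: "S (R z) = R (S z)" for z
    unfolding S_def using R by (simp add: linear_sum linear_scale funpow_swap1)
  have right: "a *\<^sub>R S z - R (S z) = (a ^ m - 1) *\<^sub>R z" for z
    using geometric_sum_funpow [OF R, where n = m and x = z] order
    by (simp add: S_def scaleR_diff_left)
  have left: "S (a *\<^sub>R z - R z) = (a ^ m - 1) *\<^sub>R z" for z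
    using S by (simp add: linear_diff linear_scale comm right)
  have "a *\<^sub>R y - R y = x \<longleftrightarrow> y = (1 / (a ^ m - 1)) *\<^sub>R S x"
  proof
    assume "a *\<^sub>R y - R y = x"
    then show "y = (1 / (a ^ m - 1)) *\<^sub>R S x"
      using left [of y] nz by auto
  next
    assume y: "y = (1 / (a ^ m - 1)) *\<^sub>R S x"
    have "a *\<^sub>R y - R y = (1 / (a ^ m - 1)) *\<^sub>R (a *\<^sub>R S x - R (S x))"
      using R by (simp add: y linear_scale scaleR_diff_right)
    then show "a *\<^sub>R y - R y = x"
      using nz by (simp add: right)
  qed
  then show ?thesis by (simp add: S_def)
qed

section \<open>The displacement operator \<open>Id - R\<close>\<close>

text \<open>
  If \<open>\<gamma> y\<close> is the value of the resolvent at \<open>x\<close>, then \<open>x - \<gamma> y = y - R y\<close>, which is the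
  shifted equation with \<open>a = 1 + \<gamma>\<close>; its solution \<open>y\<close> already carries the factor \<open>1 / \<gamma>\<close>.
\<close>

lemma resolvent_displacement:
  fixes R :: "'a::real_vector \<Rightarrow> 'a"
  assumes R: "linear R" and order: "R ^^ m = id" and m: "m > 0" and g: "\<gamma> > 0"
  shows "sv_scale (1 / \<gamma>) (resolvent (sv_scale (1 / \<gamma>) (sv_of (\<lambda>x. x - R x))))
       = sv_of (\<lambda>x. (1 / ((1 + \<gamma>) ^ m - 1)) *\<^sub>R (\<Sum>k<m. (1 + \<gamma>) ^ (m - 1 - k) *\<^sub>R (R ^^ k) x))"
proof (intro ext set_eqI)
  fix x y
  have nz: "(1 + \<gamma>) ^ m \<noteq> 1"
    using one_less_power [of "1 + \<gamma>" m] m g by linarith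
  have "y \<in> sv_scale (1 / \<gamma>) (resolvent (sv_scale (1 / \<gamma>) (sv_of (\<lambda>x. x - R x)))) x
      \<longleftrightarrow> \<gamma> *\<^sub>R (x - \<gamma> *\<^sub>R y) = \<gamma> *\<^sub>R y - R (\<gamma> *\<^sub>R y)"
    using g by (simp add: mem_sv_scale_iff mem_resolvent_iff sv_of_def)
  also have "\<dots> \<longleftrightarrow> \<gamma> *\<^sub>R (x - \<gamma> *\<^sub>R y) = \<gamma> *\<^sub>R (y - R y)"
    using R by (simp add: linear_scale scaleR_diff_right)
  also have "\<dots> \<longleftrightarrow> x - \<gamma> *\<^sub>R y = y - R y"
    using g by simp
  also have "\<dots> \<longleftrightarrow> (1 + \<gamma>) *\<^sub>R y - R y = x"
    by (auto simp: algebra_simps)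
  also have "\<dots> \<longleftrightarrow> y = (1 / ((1 + \<gamma>) ^ m - 1)) *\<^sub>R (\<Sum>k<m. (1 + \<gamma>) ^ (m - 1 - k) *\<^sub>R (R ^^ k) x)"
    by (rule shifted_finite_order_eq_iff [OF R order nz])
  finally show "y \<in> sv_scale (1 / \<gamma>) (resolvent (sv_scale (1 / \<gamma>) (sv_of (\<lambda>x. x - R x)))) x
      \<longleftrightarrow> y \<in> sv_of (\<lambda>x. (1 / ((1 + \<gamma>) ^ m - 1)) *\<^sub>R
            (\<Sum>k<m. (1 + \<gamma>) ^ (m - 1 - k) *\<^sub>R (R ^^ k) x)) x"
    by (simp add: sv_of_def)
qed

theorem theorem4p1:
  fixes R :: "'a::{real_inner, complete_space} \<Rightarrow> 'a"
    and M :: "'a sv_op"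
    and m :: nat
    and \<gamma> :: real
  assumes "(UNIV :: 'a set) \<noteq> {0}"
    and "m \<ge> 2"
    and "linear R"
    and "\<forall>x. norm (R x) = norm x"
    and "R ^^ m = id"
    and "M = sv_of (\<lambda>x. x - R x)"
    and "\<gamma> > 0"
  shows "resolvent (sv_scale \<gamma> (sv_inverse M))
           = sv_diff sv_Id (resolvent (sv_scale (1 / \<gamma>) M))
       \<and> yosida \<gamma> M
           = sv_scale (1 / \<gamma>) (sv_diff sv_Id (resolvent (sv_scale \<gamma> M)))
       \<and> yosida \<gamma> (sv_inverse M)
           = sv_scale (1 / \<gamma>) (resolvent (sv_scale (1 / \<gamma>) M))
       \<and> sv_scale (1 / \<gamma>) (resolvent (sv_scale (1 / \<gamma>) M))
           = sv_of (\<lambda>x. (1 / ((1 + \<gamma>) ^ m - 1)) *\<^sub>R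
               (\<Sum>k=0..m-1. (1 + \<gamma>) ^ (m - 1 - k) *\<^sub>R (R ^^ k) x))"
proof -
  have "linear (\<lambda>x. x - R x)"
    by (intro linear_compose_sub linear_ident \<open>linear R\<close>)
  then have inv: "sv_scale \<gamma> (sv_inverse M) = sv_inverse (sv_scale (1 / \<gamma>) M)"
    unfolding \<open>M = _\<close> using \<open>\<gamma> > 0\<close> by (intro sv_scale_sv_inverse_linear) auto
  have J: "resolvent (sv_scale \<gamma> (sv_inverse M)) = sv_diff sv_Id (resolvent (sv_scale (1 / \<gamma>) M))"
    by (simp only: inv resolvent_sv_inverse)
  have Y: "yosida \<gamma> (sv_inverse M) = sv_scale (1 / \<gamma>) (resolvent (sv_scale (1 / \<gamma>) M))"
    by (simp only: yosida_def J sv_diff_Id_involution)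
  have "{0..m - 1} = {..<m}"
    using \<open>m \<ge> 2\<close> by auto
  then have "sv_scale (1 / \<gamma>) (resolvent (sv_scale (1 / \<gamma>) M))
      = sv_of (\<lambda>x. (1 / ((1 + \<gamma>) ^ m - 1)) *\<^sub>R
          (\<Sum>k=0..m-1. (1 + \<gamma>) ^ (m - 1 - k) *\<^sub>R (R ^^ k) x))"
    using resolvent_displacement [OF \<open>linear R\<close> \<open>R ^^ m = id\<close> _ \<open>\<gamma> > 0\<close>] \<open>m \<ge> 2\<close>
    by (simp add: \<open>M = _\<close>)
  with J Y show ?thesis
    by (simp only: yosida_def simp_thms)
qed

end
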